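(* Let $Q$ and $P$ be FG-quasigroups with arithmetic forms $(Q,+,f,g,e_1)$ and $(P,+,h,k,e_2)$, respectively. Let $\varphi:Q\to P$ be a mapping such that $\varphi(0)=0$, where $0$ denotes the neutral element of $(Q,+)$ and of $(P,+)$, respectively. Then $\varphi$ is a homomorphism of the quasigroups $Q\to P$ if and only if $\varphi$ is a homomorphism of the groups $(Q,+)\to(P,+)$, $\varphi f=h\varphi$, $\varphi g=k\varphi$, and $\varphi(e_1)=e_2$.
   Context: A quasigroup is a non-empty set $Q$ with a binary operation (written multiplicatively) such that all left translations $L_a:x\mapsto ax$ and all right translations $R_a:x\mapsto xa$ are permutations of $Q$. Juxtaposition binds more tightly than $\cdot$, so $xy\cdot zw$ means $(xy)(zw)$. In a quasigroup the maps $\alpha,\beta:Q\to Q$ are defined by $x\,\alpha(x)=x=\beta(x)\,x$. $Q$ is a left F-quasigroup if $x\cdot yz = xy\cdot\alpha(x)z$ for all $x,y,z\in Q$; a right F-quasigroup if $zy\cdot x = z\beta(x)\cdot yx$ for all $x,y,z\in Q$; an F-quasigroup if it is both. A quasigroup $(Q,\cdot)$ is isotopic to a group $(G,+)$ if there are bijections $a,b,c:Q\to G$ with $c(xy)=a(x)+b(y)$ for all $x,y\in Q$. An FG-quasigroup is an F-quasigroup isotopic to a (possibly noncommutative) group. Groups are written additively even when noncommutative; $Z(Q,+)$ denotes the center of $(Q,+)$. An arithmetic form of a quasigroup $Q$ is a five-tuple $(Q,+,f,g,e)$ such that: $(Q,+)$ is a (possibly noncommutative) group on the underlying set of $Q$;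 $f,g$ are automorphisms of $(Q,+)$; $fg=gf$; $-x+f(x)\in Z(Q,+)$ and $-x+g(x)\in Z(Q,+)$ for all $x\in Q$; $e\in Q$; and $xy=f(x)+e+g(y)$ for all $x,y\in Q$. *)

theory Defs
  imports "HOL-Algebra.Group"
begin

locale quasigroup =
  fixes Q :: "'a set" and mul :: "'a \<Rightarrow> 'a \<Rightarrow> 'a" (infixl "\<cdot>" 70)
  assumes nonempty: "Q \<noteq> {}"
    and left_translation: "\<And>a. a \<in> Q \<Longrightarrow> bij_betw (\<lambda>x. a \<cdot> x) Q Q"
    and right_translation: "\<And>a. a \<in> Q \<Longrightarrow> bij_betw (\<lambda>x. x \<cdot> a) Q Q"
begin

(* In a quasigroup the two local units below exist and are unique for every x in Q. *)

definition alpha :: "'a \<Rightarrow> 'a" where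
  "alpha x = (THE u. u \<in> Q \<and> x \<cdot> u = x)"

definition beta :: "'a \<Rightarrow> 'a" where
  "beta x = (THE u. u \<in> Q \<and> u \<cdot> x = x)"

lemma alpha_closed: "x \<in> Q \<Longrightarrow> alpha x \<in> Q"
  and mul_alpha: "x \<in> Q \<Longrightarrow> x \<cdot> alpha x = x"
proof -
  assume x: "x \<in> Q"
  have "\<exists>!u. u \<in> Q \<and> x \<cdot> u = x"
    using left_translation[OF x] x unfolding bij_betw_iff_bijections by metis
  from theI'[OF this] show "alpha x \<in> Q" "x \<cdot> alpha x = x"
    unfolding alpha_def by blast+
qed

lemma beta_closed: "x \<in> Q \<Longrightarrow> beta x \<in> Q"
  and beta_mul: "x \<in> Q \<Longrightarrow> beta x \<cdot> x = x"
proof -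
  assume x: "x \<in> Q"
  have "\<exists>!u. u \<in> Q \<and> u \<cdot> x = x"
    using right_translation[OF x] x unfolding bij_betw_iff_bijections by metis
  from theI'[OF this] show "beta x \<in> Q" "beta x \<cdot> x = x"
    unfolding beta_def by blast+
qed

end

locale left_F_quasigroup = quasigroup +
  assumes left_F: "\<lbrakk>x \<in> Q; y \<in> Q; z \<in> Q\<rbrakk> \<Longrightarrow> x \<cdot> (y \<cdot> z) = (x \<cdot> y) \<cdot> (alpha x \<cdot> z)"

locale right_F_quasigroup = quasigroup +
  assumes right_F: "\<lbrakk>x \<in> Q; y \<in> Q; z \<in> Q\<rbrakk> \<Longrightarrow> (z \<cdot> y) \<cdot> x = (z \<cdot> beta x) \<cdot> (y \<cdot> x)"

locale F_quasigroup = left_F_quasigroup + right_F_quasigroup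

(* Groups, written additively in the mathematics (though not necessarily commutative), are
   HOL-Algebra groups: x + y is x \<otimes> y, -x is inv x and 0 is \<one>. *)

definition isotopic_to_group ::
    "'a set \<Rightarrow> ('a \<Rightarrow> 'a \<Rightarrow> 'a) \<Rightarrow> ('b, 'c) monoid_scheme \<Rightarrow> bool" where
  "isotopic_to_group Q mul G \<longleftrightarrow> group G \<and>
     (\<exists>a b c. bij_betw a Q (carrier G) \<and> bij_betw b Q (carrier G) \<and> bij_betw c Q (carrier G) \<and>
        (\<forall>x\<in>Q. \<forall>y\<in>Q. c (mul x y) = a x \<otimes>\<^bsub>G\<^esub> b y))"

(* The group ranges over groups whose elements have the type of those of Q.  This loses
   nothing: see isotopic_to_group_transfer. *)

locale FG_quasigroup = F_quasigroup +
  assumes isotopic_group: "\<exists>G :: 'a monoid. isotopic_to_group Q mul G"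

lemma isotopic_to_group_transfer:
  fixes Q :: "'a set" and G :: "('b, 'c) monoid_scheme"
  assumes "isotopic_to_group Q mul G"
  shows "\<exists>H :: 'a monoid. isotopic_to_group Q mul H"
proof -
  from assms obtain a b c where G: "group G" and a: "bij_betw a Q (carrier G)"
    and b: "bij_betw b Q (carrier G)" and c: "bij_betw c Q (carrier G)"
    and eq: "\<And>x y. x \<in> Q \<Longrightarrow> y \<in> Q \<Longrightarrow> c (mul x y) = a x \<otimes>\<^bsub>G\<^esub> b y"
    unfolding isotopic_to_group_def by blast
  interpret G: group G by (fact G)
  define d where "d = inv_into Q c"
  have d: "bij_betw d (carrier G) Q"
    using c by (simp add: d_def bij_betw_inv_into)
  have dG: "d u \<in> Q" if "u \<in> carrier G" for u
    using d that by (auto simp: bij_betw_def)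
  have cQ: "c x \<in> carrier G" "a x \<in> carrier G" "b x \<in> carrier G" if "x \<in> Q" for x
    using a b c that by (auto simp: bij_betw_def)
  have cd: "c (d u) = u" if "u \<in> carrier G" for u
    using c that by (simp add: d_def bij_betw_inv_into_right)
  have dc: "d (c x) = x" if "x \<in> Q" for x
    using c that by (simp add: d_def bij_betw_inv_into_left)
  define H :: "'a monoid" where
    "H = \<lparr>carrier = Q, mult = \<lambda>x y. d (c x \<otimes>\<^bsub>G\<^esub> c y), one = d \<one>\<^bsub>G\<^esub>\<rparr>"
  have H: "group H"
  proof (rule groupI)
    fix x assume "x \<in> carrier H"
    then show "\<exists>y\<in>carrier H. y \<otimes>\<^bsub>H\<^esub> x = \<one>\<^bsub>H\<^esub>"
      by (intro bexI[of _ "d (inv\<^bsub>G\<^esub> (c x))"]) (auto simp: H_def cd dG cQ)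
  qed (auto simp: H_def cd dc dG cQ G.m_assoc)
  have 1: "bij_betw (d \<circ> a) Q Q" "bij_betw (d \<circ> b) Q Q"
    using a b d by (blast intro: bij_betw_trans)+
  have 2: "d (c (mul x y)) = d (c (d (a x)) \<otimes>\<^bsub>G\<^esub> c (d (b y)))" if "x \<in> Q" "y \<in> Q" for x y
    using eq[of x y] that by (simp add: cd cQ)
  have 3: "bij_betw (d \<circ> c) Q Q"
    using c d by (rule bij_betw_trans)
  have "isotopic_to_group Q mul H"
    unfolding isotopic_to_group_def
    using H 1 2 3 by (intro conjI exI[of _ "d \<circ> a"] exI[of _ "d \<circ> b"] exI[of _ "d \<circ> c"])
      (auto simp: H_def)
  then show ?thesis by blast
qed

definition group_center :: "('a, 'b) monoid_scheme \<Rightarrow> 'a set" where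
  "group_center G = {z \<in> carrier G. \<forall>x\<in>carrier G. z \<otimes>\<^bsub>G\<^esub> x = x \<otimes>\<^bsub>G\<^esub> z}"

locale arithmetic_form =
  quasigroup Q mul + group G
  for Q :: "'a set" and mul :: "'a \<Rightarrow> 'a \<Rightarrow> 'a" (infixl "\<cdot>" 70)
    and G :: "('a, 'b) monoid_scheme" (structure)
    and f :: "'a \<Rightarrow> 'a" and g :: "'a \<Rightarrow> 'a" and e :: 'a +
  assumes carrier_eq: "carrier G = Q"
    and f_aut: "f \<in> iso G G"
    and g_aut: "g \<in> iso G G"
    and f_g_commute: "x \<in> Q \<Longrightarrow> f (g x) = g (f x)"
    and f_central: "x \<in> Q \<Longrightarrow> inv x \<otimes> f x \<in> group_center G"
    and g_central: "x \<in> Q \<Longrightarrow> inv x \<otimes> g x \<in> group_center G"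
    and e_mem: "e \<in> Q"
    and mul_eq: "\<lbrakk>x \<in> Q; y \<in> Q\<rbrakk> \<Longrightarrow> x \<cdot> y = f x \<otimes> e \<otimes> g y"

definition quasigroup_hom ::
    "'a set \<Rightarrow> ('a \<Rightarrow> 'a \<Rightarrow> 'a) \<Rightarrow> 'b set \<Rightarrow> ('b \<Rightarrow> 'b \<Rightarrow> 'b) \<Rightarrow> ('a \<Rightarrow> 'b) set" where
  "quasigroup_hom Q mulQ P mulP =
     {\<phi> \<in> Q \<rightarrow> P. \<forall>x\<in>Q. \<forall>y\<in>Q. \<phi> (mulQ x y) = mulP (\<phi> x) (\<phi> y)}"

end

theory Submission
  imports Defs
begin

text \<open>
  A homomorphism of the quasigroups satisfies \<phi>(f(x) + e1 + g(y)) = h(\<phi>(x)) + e2 + k(\<phi>(y)).  Since f and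
  v \<mapsto> e1 + g(v) are permutations of Q, the substitution a = f(x), b = e1 + g(y) turns this
  into \<phi>(a + b) = p(a) + q(b) for all a, b, with p and q maps of one variable, so that (p, q, \<phi>) is a homotopy of groups.  A homotopy
  whose third component fixes 0 has a group homomorphism there
  (\<open>hom_if_homotopy_preserving_one\<close>), hence \<phi> is additive.  Setting both arguments
  to 0 gives \<phi>(e1) = e2; setting one of them to 0 and cancelling \<phi>(e1) = e2, which additivity
  splits off, gives \<phi>f = h\<phi> and \<phi>g = k\<phi>.  The converse is a direct computation.
\<close>

text \<open>
  The values p(0) and q(0) are mutually inverse because p(0) + q(0) = \<phi>(0) = 0, so the middle of
  \<phi>(x) + \<phi>(y) = p(x) + (q(0) + p(0)) + q(y) vanishes.
\<close>

lemma hom_if_homotopy_preserving_one: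
  assumes "group G" and "group H"
    and phi: "\<phi> \<in> carrier G \<rightarrow> carrier H"
    and p: "p \<in> carrier G \<rightarrow> carrier H" and q: "q \<in> carrier G \<rightarrow> carrier H"
    and homotopy: "\<And>x y. \<lbrakk>x \<in> carrier G; y \<in> carrier G\<rbrakk> \<Longrightarrow> \<phi> (x \<otimes>\<^bsub>G\<^esub> y) = p x \<otimes>\<^bsub>H\<^esub> q y"
    and one: "\<phi> \<one>\<^bsub>G\<^esub> = \<one>\<^bsub>H\<^esub>"
  shows "\<phi> \<in> hom G H"
proof -
  interpret G: group G by fact
  interpret H: group H by fact
  have pc: "p x \<in> carrier H" and qc: "q x \<in> carrier H" if "x \<in> carrier G" for x
    using p q that by auto
  have "p \<one>\<^bsub>G\<^esub> \<otimes>\<^bsub>H\<^esub> q \<one>\<^bsub>G\<^esub> = \<one>\<^bsub>H\<^esub>"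
    using homotopy[of "\<one>\<^bsub>G\<^esub>" "\<one>\<^bsub>G\<^esub>"] one by simp
  then have inverse: "q \<one>\<^bsub>G\<^esub> \<otimes>\<^bsub>H\<^esub> p \<one>\<^bsub>G\<^esub> = \<one>\<^bsub>H\<^esub>"
    by (simp add: H.inv_comm pc qc)
  have "\<phi> (x \<otimes>\<^bsub>G\<^esub> y) = \<phi> x \<otimes>\<^bsub>H\<^esub> \<phi> y" if x: "x \<in> carrier G" and y: "y \<in> carrier G" for x y
  proof -
    have "\<phi> x = p x \<otimes>\<^bsub>H\<^esub> q \<one>\<^bsub>G\<^esub>" and "\<phi> y = p \<one>\<^bsub>G\<^esub> \<otimes>\<^bsub>H\<^esub> q y"
      using homotopy[of x "\<one>\<^bsub>G\<^esub>"] homotopy[of "\<one>\<^bsub>G\<^esub>" y] x y by simp_all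
    then have "\<phi> x \<otimes>\<^bsub>H\<^esub> \<phi> y = p x \<otimes>\<^bsub>H\<^esub> ((q \<one>\<^bsub>G\<^esub> \<otimes>\<^bsub>H\<^esub> p \<one>\<^bsub>G\<^esub>) \<otimes>\<^bsub>H\<^esub> q y)"
      using x y by (simp add: H.m_assoc pc qc)
    also have "\<dots> = \<phi> (x \<otimes>\<^bsub>G\<^esub> y)"
      using x y by (simp add: inverse homotopy pc qc)
    finally show ?thesis by simp
  qed
  then show ?thesis using phi by (auto simp: hom_def)
qed

theorem lemma6p5:
  fixes Q :: "'a set" and mulQ :: "'a \<Rightarrow> 'a \<Rightarrow> 'a"
    and G :: "'a monoid" and f g :: "'a \<Rightarrow> 'a" and e1 :: 'a
    and P :: "'b set" and mulP :: "'b \<Rightarrow> 'b \<Rightarrow> 'b"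
    and H :: "'b monoid" and h k :: "'b \<Rightarrow> 'b" and e2 :: 'b
    and \<phi> :: "'a \<Rightarrow> 'b"
  assumes "FG_quasigroup Q mulQ" and "FG_quasigroup P mulP"
    and "arithmetic_form Q mulQ G f g e1"
    and "arithmetic_form P mulP H h k e2"
    and "\<phi> \<in> Q \<rightarrow> P"
    and "\<phi> \<one>\<^bsub>G\<^esub> = \<one>\<^bsub>H\<^esub>"
  shows "\<phi> \<in> quasigroup_hom Q mulQ P mulP \<longleftrightarrow>
           \<phi> \<in> hom G H \<and>
           (\<forall>x\<in>Q. \<phi> (f x) = h (\<phi> x)) \<and>
           (\<forall>x\<in>Q. \<phi> (g x) = k (\<phi> x)) \<and>
           \<phi> e1 = e2"
proof -
  interpret A: arithmetic_form Q mulQ G f g e1 by fact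
  interpret B: arithmetic_form P mulP H h k e2 by fact
  note [simp] = A.carrier_eq B.carrier_eq A.e_mem B.e_mem
  have unit_mem [simp]: "\<one>\<^bsub>G\<^esub> \<in> Q" "\<one>\<^bsub>H\<^esub> \<in> P"
    using A.one_closed B.one_closed by simp_all
  have phi [simp]: "\<phi> x \<in> P" if "x \<in> Q" for x
    using assms(5) that by auto
  have f_bij: "bij_betw f Q Q" and g_bij: "bij_betw g Q Q"
    using A.f_aut A.g_aut by (simp_all add: iso_def)
  have [simp]: "f x \<in> Q" "g x \<in> Q" if "x \<in> Q" for x
    using f_bij g_bij that by (auto simp: bij_betw_def)
  have hk_hom: "h \<in> hom H H" "k \<in> hom H H"
    using B.f_aut B.g_aut by (simp_all add: iso_def)
  have [simp]: "h y \<in> P" "k y \<in> P" if "y \<in> P" for y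
    using hk_hom that by (auto simp: hom_def)
  have "f \<in> hom G G" "g \<in> hom G G"
    using A.f_aut A.g_aut by (simp_all add: iso_def)
  then have units [simp]: "f \<one>\<^bsub>G\<^esub> = \<one>\<^bsub>G\<^esub>" "g \<one>\<^bsub>G\<^esub> = \<one>\<^bsub>G\<^esub>" "h \<one>\<^bsub>H\<^esub> = \<one>\<^bsub>H\<^esub>" "k \<one>\<^bsub>H\<^esub> = \<one>\<^bsub>H\<^esub>"
    using hk_hom A.is_group B.is_group by (auto intro: hom_one)
  note A_closed [simp] = A.m_closed[simplified] A.inv_closed[simplified]
  note B_closed [simp] = B.m_closed[simplified]
  note A_laws [simp] = A.l_one[simplified] A.r_one[simplified]
  note B_laws [simp] = B.l_one[simplified] B.r_one[simplified]
  have B_assoc: "x \<otimes>\<^bsub>H\<^esub> y \<otimes>\<^bsub>H\<^esub> z = x \<otimes>\<^bsub>H\<^esub> (y \<otimes>\<^bsub>H\<^esub> z)" if "x \<in> P" "y \<in> P" "z \<in> P" for x y z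
    using that by (simp add: B.m_assoc)
  show ?thesis
  proof
    assume "\<phi> \<in> quasigroup_hom Q mulQ P mulP"
    then have hom: "\<phi> (f x \<otimes>\<^bsub>G\<^esub> e1 \<otimes>\<^bsub>G\<^esub> g y) = h (\<phi> x) \<otimes>\<^bsub>H\<^esub> e2 \<otimes>\<^bsub>H\<^esub> k (\<phi> y)"
      if "x \<in> Q" "y \<in> Q" for x y
      using that by (simp add: quasigroup_hom_def A.mul_eq B.mul_eq)
    have e: "\<phi> e1 = e2"
      using hom[of "\<one>\<^bsub>G\<^esub>" "\<one>\<^bsub>G\<^esub>"] assms(6) by simp
    \<comment> \<open>Solving a = f(x) and b = e1 + g(y) for x and y splits the right-hand side h(\<phi>(x)) + e2 + k(\<phi>(y))
      into a function of a and a function of b.\<close>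
    define p where "p = (\<lambda>a. h (\<phi> (inv_into Q f a)))"
    define q where "q = (\<lambda>b. e2 \<otimes>\<^bsub>H\<^esub> k (\<phi> (inv_into Q g (inv\<^bsub>G\<^esub> e1 \<otimes>\<^bsub>G\<^esub> b))))"
    have f_inv: "inv_into Q f a \<in> Q" "f (inv_into Q f a) = a" if "a \<in> Q" for a
      using f_bij that by (auto simp: bij_betw_def inv_into_into f_inv_into_f)
    have g_inv: "inv_into Q g b \<in> Q" "g (inv_into Q g b) = b" if "b \<in> Q" for b
      using g_bij that by (auto simp: bij_betw_def inv_into_into f_inv_into_f)
    have homotopy: "\<phi> (a \<otimes>\<^bsub>G\<^esub> b) = p a \<otimes>\<^bsub>H\<^esub> q b" if a: "a \<in> Q" and b: "b \<in> Q" for a b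
    proof -
      have "a \<otimes>\<^bsub>G\<^esub> e1 \<otimes>\<^bsub>G\<^esub> (inv\<^bsub>G\<^esub> e1 \<otimes>\<^bsub>G\<^esub> b) = a \<otimes>\<^bsub>G\<^esub> b"
        using a b by (simp add: A.m_assoc flip: A.m_assoc[of e1])
      then show ?thesis
        using hom[of "inv_into Q f a" "inv_into Q g (inv\<^bsub>G\<^esub> e1 \<otimes>\<^bsub>G\<^esub> b)"] a b
        by (simp add: p_def q_def f_inv g_inv B_assoc)
    qed
    have phi_hom: "\<phi> \<in> hom G H"
    proof (rule hom_if_homotopy_preserving_one)
      show "group G" "group H"
        by (fact A.is_group, fact B.is_group)
      show "\<phi> \<in> carrier G \<rightarrow> carrier H" "p \<in> carrier G \<rightarrow> carrier H" "q \<in> carrier G \<rightarrow> carrier H"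
        by (auto simp: p_def q_def f_inv g_inv)
    qed (simp_all add: homotopy assms(6))
    have add: "\<phi> (x \<otimes>\<^bsub>G\<^esub> y) = \<phi> x \<otimes>\<^bsub>H\<^esub> \<phi> y" if "x \<in> Q" "y \<in> Q" for x y
      using phi_hom that by (simp add: hom_def)
    have "\<phi> (f x) = h (\<phi> x)" if "x \<in> Q" for x
      using hom[of x "\<one>\<^bsub>G\<^esub>"] that by (simp add: add e assms(6))
    moreover have "\<phi> (g x) = k (\<phi> x)" if "x \<in> Q" for x
      using hom[of "\<one>\<^bsub>G\<^esub>" x] that by (simp add: add e assms(6))
    ultimately show "\<phi> \<in> hom G H \<and> (\<forall>x\<in>Q. \<phi> (f x) = h (\<phi> x)) \<and>
        (\<forall>x\<in>Q. \<phi> (g x) = k (\<phi> x)) \<and> \<phi> e1 = e2"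
      using phi_hom e by blast
  next
    assume "\<phi> \<in> hom G H \<and> (\<forall>x\<in>Q. \<phi> (f x) = h (\<phi> x)) \<and>
        (\<forall>x\<in>Q. \<phi> (g x) = k (\<phi> x)) \<and> \<phi> e1 = e2"
    then show "\<phi> \<in> quasigroup_hom Q mulQ P mulP"
      by (auto simp: quasigroup_hom_def hom_def A.mul_eq B.mul_eq)
  qed
qed

end
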